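(* Let $q$ be a prime power, let $1\le r\le k$, and let $C$ be an $[n,k]_q$ code that is an $r$-th generalized antiGriesmer code. Write $\delta_i=\delta_i(C)$. 1. Let $1\le h<r$, and let $A\le C$ be an $h$-dimensional subcode with support weight $\delta_h$. Put $R=\mathrm{Res}(C,A)$, $k'=\dim R$, and $m=\min\{k',r-h\}$. If $R=0$, then $n=\delta_h=\delta_r$. If $R\neq 0$, then $$n(R)=a_q^{(m)}(k',\delta_r-\delta_h)\quad\text{and}\quad \delta_m(R)=\delta_r-\delta_h.$$ Thus, in the case $R\ne0$, $R$ is an $m$-th generalized antiGriesmer code. 2. Suppose that $r<k$. Let $A\le C$ be an $r$-dimensional subcode with support weight $\delta_r$, and suppose that $R=\mathrm{Res}(C,A)$ is nonzero. If $k'=\dim R$, then $R$ has length $a_q(k',\delta_{r+1}-\delta_r)$, dimension $k'$, and maximum Hamming weight $\delta_{r+1}-\delta_r$. Hence $R$ is an antiGriesmer code.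
   Context: An $[n,k]_q$ code is a $k$-dimensional linear subspace $C\le\mathbb{F}_q^n$. For a subcode $A\le C$, $\mathrm{supp}(A)$ is the set of coordinates $j$ such that $a_j\neq 0$ for some $a\in A$, and its support weight is $w(A)=|\mathrm{supp}(A)|$. The effective length of $C$ is $n(C)=w(C)$; $C$ has full length if $n(C)=n$. For $1\le r\le k$, $\delta_r(C)$ is the maximum of $w(A)$ over all $r$-dimensional subcodes $A\le C$; so $\delta_1(C)$ is the maximum Hamming weight. Put ${r\brack 1}_q=(q^r-1)/(q-1)$ and, for integers $x\ge 0$ and $1\le r\le k$, $$a_q^{(r)}(k,x)=x+\sum_{i=1}^{k-r}\left\lfloor\frac{x}{q^i{r\brack 1}_q}\right\rfloor,\qquad a_q(k,x)=a_q^{(1)}(k,x)$$ (empty sums are zero). A full-length $[n,k]_q$ code $C$ is an $r$-th generalized antiGriesmer code if $n=a_q^{(r)}(k,\delta_r(C))$; an antiGriesmer code is a first ($r=1$) generalized antiGriesmer code. For a subcode $A\le C$, the residual code is $\mathrm{Res}(C,A)=\{(c_j)_{j\notin\mathrm{supp}(A)}:c\in C\}$; coordinates that are identically zero after puncturing are deleted, so residual codes are always written with their effective lengths. *)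

theory Defs
  imports "HOL-Analysis.Cartesian_Space"
begin

text \<open>
  The field F_q is a finite field type \<open>'a\<close> with \<open>q = CARD('a)\<close>, and words are vectors in
  \<open>'a ^ 'n\<close>.  Puncturing changes the set of coordinates, so a code comes with an explicit
  coordinate set \<open>J\<close>: the space of words indexed by \<open>J\<close> is identified with the vectors that
  vanish outside \<open>J\<close>.  The ambient space F_q^n is the case \<open>J = UNIV\<close>, \<open>n = CARD('n)\<close>.
\<close>

definition supp :: "('a::zero ^ 'n) set \<Rightarrow> 'n set" where
  "supp A = {j. \<exists>a\<in>A. a $ j \<noteq> 0}"

definition support_weight :: "('a::zero ^ 'n::finite) set \<Rightarrow> nat" where
  "support_weight A = card (supp A)"

definition linear_code :: "'n set \<Rightarrow> nat \<Rightarrow> nat \<Rightarrow> ('a::field ^ 'n::finite) set \<Rightarrow> bool" where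
  "linear_code J n k C \<longleftrightarrow>
     card J = n \<and> vec.subspace C \<and> (\<forall>c\<in>C. \<forall>j. j \<notin> J \<longrightarrow> c $ j = 0) \<and> vec.dim C = k"

definition subcode :: "nat \<Rightarrow> ('a::field ^ 'n::finite) set \<Rightarrow> ('a ^ 'n) set \<Rightarrow> bool" where
  "subcode r A C \<longleftrightarrow> vec.subspace A \<and> A \<subseteq> C \<and> vec.dim A = r"

abbreviation effective_length :: "('a::zero ^ 'n::finite) set \<Rightarrow> nat" where
  "effective_length C \<equiv> support_weight C"

definition max_weight :: "nat \<Rightarrow> ('a::{field,finite} ^ 'n::finite) set \<Rightarrow> nat" where
  "max_weight r C = Max (support_weight ` {A. subcode r A C})"

definition max_hamming_weight :: "('a::{field,finite} ^ 'n::finite) set \<Rightarrow> nat" where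
  "max_hamming_weight C = Max ((\<lambda>c. card {j. c $ j \<noteq> 0}) ` C)"

definition q_bracket :: "nat \<Rightarrow> nat \<Rightarrow> nat" where
  "q_bracket q r = (q ^ r - 1) div (q - 1)"  \<comment> \<open>the division is exact\<close>

definition antiGriesmer_bound :: "nat \<Rightarrow> nat \<Rightarrow> nat \<Rightarrow> nat \<Rightarrow> nat" where
  "antiGriesmer_bound q r k x = x + (\<Sum>i=1..k - r. x div (q ^ i * q_bracket q r))"

definition gen_antiGriesmer ::
  "nat \<Rightarrow> 'n set \<Rightarrow> nat \<Rightarrow> nat \<Rightarrow> ('a::{field,finite} ^ 'n::finite) set \<Rightarrow> bool" where
  "gen_antiGriesmer r J n k C \<longleftrightarrow>
     linear_code J n k C \<and> effective_length C = n \<and> 1 \<le> r \<and> r \<le> k \<and>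
     n = antiGriesmer_bound CARD('a) r k (max_weight r C)"

abbreviation antiGriesmer ::
  "'n set \<Rightarrow> nat \<Rightarrow> nat \<Rightarrow> ('a::{field,finite} ^ 'n::finite) set \<Rightarrow> bool" where
  "antiGriesmer \<equiv> gen_antiGriesmer 1"

text \<open>
  Deleting the coordinates in \<open>supp A\<close> is setting them to zero under the identification above.
  After also deleting the identically zero coordinates, the coordinate set of
  \<open>Res C A\<close> is \<open>supp (Res C A)\<close>, and its length is its effective length.
\<close>

definition Res :: "('a::zero ^ 'n::finite) set \<Rightarrow> ('a ^ 'n) set \<Rightarrow> ('a ^ 'n) set" where
  "Res C A = (\<lambda>c. \<chi> j. if j \<in> supp A then 0 else c $ j) ` C"

text \<open>
  \<open>max_weight\<close> is monotone in the dimension, so differences of its values on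
  natural numbers do not truncate.
\<close>

lemma subcode_extend:
  fixes C :: "('a::field ^ 'n::finite) set"
  assumes C: "vec.subspace C" and A: "subcode h A C" and r: "h \<le> r" "r \<le> vec.dim C"
  shows "\<exists>B. subcode r B C \<and> A \<subseteq> B"
proof -
  obtain S where S: "S \<subseteq> A" "vec.independent S" "A \<subseteq> vec.span S" "card S = vec.dim A"
    using vec.basis_exists by blast
  have SC: "S \<subseteq> C" using S(1) A by (auto simp: subcode_def)
  obtain T where T: "S \<subseteq> T" "T \<subseteq> C" "vec.independent T" "C \<subseteq> vec.span T"
    using vec.maximal_independent_subset_extend[OF SC S(2)] by blast
  have cT: "card T = vec.dim C"
    using vec.dim_unique[OF T(2,4,3) refl] by simp
  have fT: "finite T" using T(3) vec.finiteI_independent by blast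
  have cS: "card S = h" using S(4) A by (simp add: subcode_def)
  obtain U where U: "S \<subseteq> U" "U \<subseteq> T" "card U = r"
    using exists_subset_between[of S r T] cS cT r T(1) fT by metis
  have iU: "vec.independent U" using U(2) T(3) vec.independent_mono by blast
  have "subcode r (vec.span U) C"
    unfolding subcode_def
    using vec.dim_span_eq_card_independent[OF iU] U T(2) C vec.span_minimal[of U C]
    by (auto simp: vec.subspace_span)
  moreover have "A \<subseteq> vec.span U" using S(3) vec.span_mono[OF U(1)] by blast
  ultimately show ?thesis by blast
qed

lemma max_weight_mono:
  fixes C :: "('a::{field,finite} ^ 'n::finite) set"
  assumes C: "vec.subspace C" and r: "h \<le> r" "r \<le> vec.dim C"
  shows "max_weight h C \<le> max_weight r C"
proof -
  have "subcode 0 {0} C" using C by (auto simp: subcode_def vec.subspace_0)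
  then have ne: "{A. subcode h A C} \<noteq> {}"
    using subcode_extend[OF C, of 0 "{0}" h] r by auto
  have fin: "finite {A. subcode i A C}" for i
    by (rule finite_subset[of _ "Pow UNIV"]) (auto simp: finite)
  have "max_weight h C \<in> support_weight ` {A. subcode h A C}"
    unfolding max_weight_def using ne fin by (intro Max_in) auto
  then obtain A where A: "subcode h A C" "max_weight h C = support_weight A" by auto
  obtain B where B: "subcode r B C" "A \<subseteq> B" using subcode_extend[OF C A(1) r] by blast
  have "support_weight A \<le> support_weight B"
    unfolding support_weight_def using B(2) by (intro card_mono) (auto simp: supp_def)
  also have "\<dots> \<le> max_weight r C"
    unfolding max_weight_def using B(1) fin by (intro Max_ge) auto
  finally show ?thesis using A(2) by simp
qed

end

theory Submission
  imports Defs
begin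

text \<open>
  Averaging support weights over the kernels of all nonzero functionals on an \<open>(s + 1)\<close>-dimensional
  subcode bounds \<open>\<delta>\<^bsub>s+1\<^esub>\<close> in terms of \<open>\<delta>\<^sub>s\<close>.  Passing to the residual of a subcode of maximal weight,
  this yields \<open>n(C) \<le> x + (\<Sum>i=1..k - r. x div (q\<^sup>i * q_bracket q r))\<close> with \<open>x = \<delta>\<^sub>r\<close> for every code,
  by induction on \<open>k\<close>.
  For a code that meets the bound, the length of its residual code is squeezed between two equal
  quantities, and since the bound is strictly increasing in \<open>x\<close> the relevant maximum weight of the
  residual code is determined.
\<close>

section \<open>The numbers \<open>q_bracket\<close> and the bound\<close>

lemma q_bracket_0 [simp]: "q_bracket q 0 = 0"
  by (simp add: q_bracket_def)

text \<open>The factorization of \<open>q ^ i - 1\<close> as a geometric sum times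
  \<open>q - 1\<close> is taken from the integers. It gives a divisibility, which transfers back to
  the naturals, where subtraction truncates.\<close>

lemma q_bracket_exact:
  assumes "2 \<le> q"
  shows "(q - 1) * q_bracket q i = q ^ i - 1"
proof -
  have "int q - 1 dvd int q ^ i - 1"
    using power_diff_1_eq[of "int q" i] by simp
  then have "int (q - 1) dvd int (q ^ i - 1)"
    using assms by (simp add: of_nat_diff)
  then have "q - 1 dvd q ^ i - 1" by (simp only: of_nat_dvd_iff)
  then show ?thesis by (simp add: q_bracket_def)
qed

lemma q_bracket_Suc:
  assumes "2 \<le> q"
  shows "q_bracket q (Suc s) = 1 + q * q_bracket q s"
proof -
  \<comment> \<open>Keeps the natural subtraction \<open>q * q ^ s - q\<close> from
    truncating.\<close>
  have "q \<le> q * q ^ s" using assms by simp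
  then have "q ^ Suc s - 1 = (q - 1) + q * (q ^ s - 1)"
    using assms by (simp add: diff_mult_distrib2)
  also have "\<dots> = (q - 1) * (1 + q * q_bracket q s)"
    by (simp only: q_bracket_exact[OF assms, symmetric] distrib_left mult_1_right mult.left_commute)
  finally have "(q - 1) * q_bracket q (Suc s) = (q - 1) * (1 + q * q_bracket q s)"
    by (simp only: q_bracket_exact[OF assms])
  moreover have "q - 1 \<noteq> 0" using assms by simp
  ultimately show ?thesis by (metis mult_left_cancel)
qed

lemma q_bracket_1 [simp]: "2 \<le> q \<Longrightarrow> q_bracket q 1 = 1"
  using q_bracket_Suc[of q 0] by simp

lemma q_bracket_pos: "2 \<le> q \<Longrightarrow> 1 \<le> r \<Longrightarrow> 0 < q_bracket q r"
  by (cases r) (auto simp: q_bracket_Suc)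

text \<open>The geometric sum 1 + q + ... with d + h terms, cut after the first d of them.\<close>

lemma q_bracket_add:
  assumes "2 \<le> q"
  shows "q_bracket q (d + h) = q_bracket q d + q ^ d * q_bracket q h"
  by (induction d) (use assms in \<open>simp_all add: q_bracket_Suc algebra_simps\<close>)

lemma antiGriesmer_bound_mono:
  assumes "k \<le> l" "x \<le> y"
  shows "antiGriesmer_bound q r k x \<le> antiGriesmer_bound q r l y"
proof -
  have "(\<Sum>i=1..k - r. x div (q ^ i * q_bracket q r)) \<le> (\<Sum>i=1..k - r. y div (q ^ i * q_bracket q r))"
    using assms by (intro sum_mono div_le_mono)
  also have "\<dots> \<le> (\<Sum>i=1..l - r. y div (q ^ i * q_bracket q r))"
    using assms by (intro sum_mono2) auto
  finally show ?thesis using assms by (simp add: antiGriesmer_bound_def)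
qed

text \<open>The leading summand \<open>x\<close> grows strictly and the floors never decrease.
  Equality of two bounds will therefore pin down the maximum weight.\<close>

lemma antiGriesmer_bound_strict_mono:
  assumes "k \<le> l" "x < y"
  shows "antiGriesmer_bound q r k x < antiGriesmer_bound q r l y"
proof -
  have "antiGriesmer_bound q r k x < antiGriesmer_bound q r k (Suc x)"
  proof -
    have "(\<Sum>i=1..k - r. x div (q ^ i * q_bracket q r))
        \<le> (\<Sum>i=1..k - r. Suc x div (q ^ i * q_bracket q r))"
      by (intro sum_mono div_le_mono) simp
    then show ?thesis by (simp add: antiGriesmer_bound_def)
  qed
  also have "\<dots> \<le> antiGriesmer_bound q r l y"
    using assms by (intro antiGriesmer_bound_mono) auto
  finally show ?thesis .
qed

text \<open>Nested floors compose, so all summands can be divided by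
  \<open>q * q_bracket q r\<close> first. What follows \<open>x\<close> is then a bound for r = 1,
  the one that a residual code has to obey.\<close>

lemma antiGriesmer_bound_unfold:
  assumes "2 \<le> q" "r < k"
  shows "antiGriesmer_bound q r k x
       = x + antiGriesmer_bound q 1 (k - r) (x div (q * q_bracket q r))"
proof -
  obtain d where d: "k - r = Suc d" using assms by (metis Suc_diff_Suc)
  have "(\<Sum>i=1..Suc d. x div (q ^ i * q_bracket q r))
      = x div (q * q_bracket q r) + (\<Sum>i=1..d. x div (q ^ Suc i * q_bracket q r))"
    using sum.atLeast_Suc_atMost[of 1 "Suc d" "\<lambda>i. x div (q ^ i * q_bracket q r)"]
      sum.shift_bounds_cl_Suc_ivl[of "\<lambda>i. x div (q ^ i * q_bracket q r)" 1 d]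
    by simp
  also have "\<dots> = x div (q * q_bracket q r)
      + (\<Sum>i=1..d. x div (q * q_bracket q r) div (q ^ i * q_bracket q 1))"
    using assms by (simp add: div_mult2_eq[symmetric] ac_simps flip: One_nat_def)
  finally show ?thesis by (simp add: antiGriesmer_bound_def d)
qed

section \<open>Supports and maximum weights\<close>

lemma two_le_card_field: "2 \<le> CARD('a::{field,finite})"
proof -
  have "card {0, 1 :: 'a} \<le> CARD('a)" by (intro card_mono) auto
  then show ?thesis by simp
qed

lemma supp_mono: "A \<subseteq> B \<Longrightarrow> supp A \<subseteq> supp B"
  by (auto simp: supp_def)

lemma supp_Un: "supp (A \<union> B) = supp A \<union> supp B"
  by (auto simp: supp_def)

lemma supp_span: "supp (vec.span S) = supp (S :: ('a::field ^ 'n::finite) set)"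
proof
  have "vec.subspace {x :: 'a ^ 'n. \<forall>j. j \<notin> supp S \<longrightarrow> x $ j = 0}"
    by (auto simp: vec.subspace_def)
  then have "vec.span S \<subseteq> {x. \<forall>j. j \<notin> supp S \<longrightarrow> x $ j = 0}"
    by (intro vec.span_minimal) (auto simp: supp_def)
  then show "supp (vec.span S) \<subseteq> supp S" by (auto simp: supp_def)
qed (simp add: supp_mono vec.span_superset)

lemma support_weight_eq_0:
  "support_weight (C :: ('a::zero ^ 'n::finite) set) = 0 \<longleftrightarrow> C \<subseteq> {0}"
  by (auto simp: support_weight_def supp_def vec_eq_iff)

lemma linear_code_supp:
  assumes "vec.subspace C"
  shows "linear_code (supp C) (support_weight C) (vec.dim C) C"
  using assms by (auto simp: linear_code_def support_weight_def supp_def)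

lemma finite_subcodes [simp]: "finite {A. subcode r A (C :: ('a::{field,finite} ^ 'n::finite) set)}"
  by (rule finite_subset[of _ "Pow UNIV"]) (auto simp: finite)

lemma support_weight_le_max_weight:
  "subcode r A C \<Longrightarrow> support_weight A \<le> max_weight r C"
  unfolding max_weight_def by (intro Max_ge) auto

lemma max_weight_attained:
  fixes C :: "('a::{field,finite} ^ 'n::finite) set"
  assumes "vec.subspace C" "r \<le> vec.dim C"
  obtains A where "subcode r A C" "support_weight A = max_weight r C"
proof -
  have "subcode 0 {0} C" using assms by (auto simp: subcode_def vec.subspace_0)
  then have "{A. subcode r A C} \<noteq> {}"
    using subcode_extend[OF assms(1), of 0 "{0}" r] assms by auto
  then have "max_weight r C \<in> support_weight ` {A. subcode r A C}"
    unfolding max_weight_def by (intro Max_in) auto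
  then show ?thesis using that by auto
qed

lemma max_weight_le:
  fixes C :: "('a::{field,finite} ^ 'n::finite) set"
  assumes "vec.subspace C" "r \<le> vec.dim C" "\<And>A. subcode r A C \<Longrightarrow> support_weight A \<le> b"
  shows "max_weight r C \<le> b"
  using max_weight_attained[OF assms(1,2)] assms(3) by metis

lemma max_weight_le_support_weight:
  fixes C :: "('a::{field,finite} ^ 'n::finite) set"
  assumes "vec.subspace C" "r \<le> vec.dim C"
  shows "max_weight r C \<le> support_weight C"
  using assms
  by (intro max_weight_le) (auto simp: support_weight_def subcode_def intro!: card_mono supp_mono)

text \<open>The one-dimensional subcodes are the spans of nonzero words, and a word has the same
  support as its span. The zero word adds only the value 0.\<close>

lemma max_hamming_weight_eq:
  fixes C :: "('a::{field,finite} ^ 'n::finite) set"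
  assumes C: "vec.subspace C" and d: "1 \<le> vec.dim C"
  shows "max_hamming_weight C = max_weight 1 C"
proof (rule antisym)
  have wt: "card {j. c $ j \<noteq> 0} = support_weight (vec.span {c})" for c :: "'a ^ 'n"
    by (simp add: support_weight_def supp_span) (simp add: supp_def)
  show "max_hamming_weight C \<le> max_weight 1 C"
    unfolding max_hamming_weight_def
  proof (intro Max.boundedI)
    fix w assume "w \<in> (\<lambda>c. card {j. c $ j \<noteq> 0}) ` C"
    then obtain c where c: "c \<in> C" "w = card {j. c $ j \<noteq> 0}" by auto
    show "w \<le> max_weight 1 C"
    proof (cases "c = 0")
      case False
      then have "subcode 1 (vec.span {c}) C"
        using c vec.span_minimal[OF _ C, of "{c}"]
        by (auto simp: subcode_def vec.subspace_span vec.dim_insert)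
      then show ?thesis using c wt support_weight_le_max_weight by metis
    qed (use c in simp)
  qed (use C vec.subspace_0 in auto)
  show "max_weight 1 C \<le> max_hamming_weight C"
  proof (rule max_weight_le[OF C d])
    fix A assume A: "subcode 1 A C"
    obtain S where S: "S \<subseteq> A" "A \<subseteq> vec.span S" "card S = 1"
      using A vec.basis_exists[of A] by (metis subcode_def)
    obtain c where c: "S = {c}" using S(3) card_1_singletonE by blast
    have "A = vec.span {c}"
      using S A vec.span_minimal[of S A] c by (auto simp: subcode_def)
    moreover have "c \<in> C" using S(1) c A by (auto simp: subcode_def)
    ultimately show "support_weight A \<le> max_hamming_weight C"
      unfolding max_hamming_weight_def by (auto simp: wt[symmetric] intro!: Max_ge)
  qed
qed

section \<open>Averaging over hyperplanes\<close>

text \<open>Subtracting \<open>f b / f v\<close> times \<open>v\<close> from \<open>b\<close> gives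
  an element of the kernel, so \<open>v\<close> and the kernel span \<open>B\<close>. Linearity is
  asked for on \<open>B\<close> only, because functionals built from
  \<open>vec.representation\<close> are linear only on the span of the basis.\<close>

lemma dim_hyperplane:
  fixes B :: "('a::field ^ 'n::finite) set" and f :: "'a ^ 'n \<Rightarrow> 'a"
  assumes B: "vec.subspace B" and v: "v \<in> B" "f v \<noteq> 0"
    and add: "\<And>x y. x \<in> B \<Longrightarrow> y \<in> B \<Longrightarrow> f (x + y) = f x + f y"
    and scale: "\<And>c x. x \<in> B \<Longrightarrow> f (c *s x) = c * f x"
  shows "vec.subspace {b \<in> B. f b = 0} \<and> Suc (vec.dim {b \<in> B. f b = 0}) = vec.dim B"
proof -
  let ?K = "{b \<in> B. f b = 0}"
  have "f 0 = 0" using scale[of 0 0] vec.subspace_0[OF B] by simp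
  then have K: "vec.subspace ?K"
    using B add scale by (auto simp: vec.subspace_def)
  have "B \<subseteq> vec.span (insert v ?K)"
  proof
    fix b assume b: "b \<in> B"
    let ?c = "f b / f v"
    have "b - ?c *s v = b + (- ?c) *s v" by (simp add: vec_eq_iff)
    then have "f (b - ?c *s v) = 0"
      using add[OF b vec.subspace_scale[OF B v(1), of "- ?c"]] scale[OF v(1), of "- ?c"] v by simp
    then have "b - ?c *s v \<in> vec.span ?K"
      using b v B by (auto intro!: vec.span_base vec.subspace_diff vec.subspace_scale)
    then show "b \<in> vec.span (insert v ?K)"
      by (auto simp: vec.span_insert)
  qed
  moreover have "vec.span (insert v ?K) \<subseteq> B"
    using v B by (intro vec.span_minimal) auto
  ultimately have "vec.dim B = vec.dim (insert v ?K)" by (metis vec.dim_span subset_antisym)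
  moreover have "v \<notin> vec.span ?K" using vec.span_minimal[OF subset_refl K] v(2) by auto
  ultimately show ?thesis using K by (simp add: vec.dim_insert)
qed

text \<open>Double counting of pairs of a nonzero functional \<open>y\<close> on \<open>B\<close>
  and a coordinate in the support of its kernel. Each coordinate of \<open>supp B\<close> is missed
  by at most q - 1 kernels, and each kernel has weight at most
  \<open>max_weight s C\<close>.\<close>

lemma support_weight_averaging:
  fixes C B :: "('a::{field,finite} ^ 'n::finite) set"
  assumes B: "subcode (Suc s) B C"
  shows "CARD('a) * q_bracket CARD('a) s * support_weight B
       \<le> q_bracket CARD('a) (Suc s) * max_weight s C"
proof -
  let ?q = "CARD('a)"
  have q: "2 \<le> ?q" by (rule two_le_card_field)
  obtain S where S: "S \<subseteq> B" "vec.independent S" "B \<subseteq> vec.span S" "card S = Suc s"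
    using vec.basis_exists[of B] B by (metis subcode_def)
  have B_sub: "vec.subspace B" and BC: "B \<subseteq> C" using B by (auto simp: subcode_def)
  have fS: "finite S" using S(4) by (metis card.infinite Zero_not_Suc)
  txt \<open>A functional on \<open>B\<close> is encoded by its values on the basis \<open>S\<close>.\<close>
  define Y where "Y = PiE S (\<lambda>_. UNIV :: 'a set) - {\<lambda>v\<in>S. 0}"
  define f where "f = (\<lambda>(y :: 'a ^ 'n \<Rightarrow> 'a) b. \<Sum>v\<in>S. vec.representation S b v * y v)"
  define K where "K = (\<lambda>y. {b \<in> B. f y b = 0})"
  have f_add: "f y (b + c) = f y b + f y c" if "b \<in> B" "c \<in> B" for y b c
    using that[THEN subsetD[OF S(3)]] vec.representation_add[OF S(2), of c b]
    by (auto simp: f_def sum.distrib distrib_right)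
  have f_scale: "f y (c *s b) = c * f y b" if "b \<in> B" for y b c
    using that[THEN subsetD[OF S(3)]] vec.representation_scale[OF S(2), of b c]
    by (auto simp: f_def sum_distrib_left mult.assoc)
  have f_basis: "f y v = y v" if "v \<in> S" for y v
  proof -
    have "f y v = (\<Sum>u\<in>S. if u = v then y u else 0)"
      using that vec.representation_basis[OF S(2)] unfolding f_def
      by (intro sum.cong) auto
    then show ?thesis using that fS by simp
  qed
  have Y_nz: "\<exists>v\<in>S. y v \<noteq> 0" if "y \<in> Y" for y
  proof (rule ccontr)
    assume "\<not> (\<exists>v\<in>S. y v \<noteq> 0)"
    then have "y = (\<lambda>v\<in>S. 0)" using that by (auto simp: Y_def PiE_def extensional_def)
    then show False using that by (simp add: Y_def)
  qed
  have K_sub: "subcode s (K y) C" if "y \<in> Y" for y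
  proof -
    obtain v where v: "v \<in> S" "y v \<noteq> 0" using Y_nz[OF \<open>y \<in> Y\<close>] by blast
    then have "vec.subspace (K y) \<and> Suc (vec.dim (K y)) = vec.dim B"
      unfolding K_def
      using S(1) f_basis f_add f_scale by (intro dim_hyperplane[OF B_sub, of v]) auto
    then show ?thesis using B BC by (auto simp: subcode_def K_def)
  qed
  have fPi: "finite (PiE S (\<lambda>_. UNIV :: 'a set))" using fS by (intro finite_PiE) auto
  then have fY: "finite Y" by (simp add: Y_def)
  have cY: "card Y = ?q ^ Suc s - 1"
  proof -
    have "card (PiE S (\<lambda>_. UNIV :: 'a set)) = ?q ^ Suc s"
      using fS S(4) by (simp add: card_PiE)
    moreover have "(\<lambda>v\<in>S. 0) \<in> PiE S (\<lambda>_. UNIV :: 'a set)" by simp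
    ultimately show ?thesis by (simp add: Y_def)
  qed
  txt \<open>A functional whose kernel misses the coordinate \<open>j\<close> is a nonzero multiple of the
    evaluation at \<open>j\<close>.\<close>
  have missed: "card {y \<in> Y. j \<notin> supp (K y)} \<le> ?q - 1" if j: "j \<in> supp B" for j
  proof -
    have "{y \<in> Y. j \<notin> supp (K y)} \<subseteq> (\<lambda>\<mu>. \<lambda>v\<in>S. \<mu> * v $ j) ` (UNIV - {0})"
    proof safe
      fix y assume y: "y \<in> Y" and nj: "j \<notin> supp (K y)"
      obtain v where v: "v \<in> S" "y v \<noteq> 0" using Y_nz[OF y] by blast
      have vB: "v \<in> B" using v S(1) by auto
      \<comment> \<open>The combination of \<open>b\<close> and \<open>v\<close> that lies in the
        kernel of \<open>f y\<close> vanishes at \<open>j\<close>, so the values at \<open>j\<close>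
        are proportional to those of \<open>f y\<close>.\<close>
      have ratio: "b $ j = f y b / y v * v $ j" if b: "b \<in> B" for b
      proof -
        let ?c = "f y b / y v"
        have "f y (b + (- ?c) *s v) = 0"
          using f_add[OF b vec.subspace_scale[OF B_sub vB, of "- ?c"], of y]
            f_scale[OF vB, of y "- ?c"] f_basis[OF v(1), of y] v
          by simp
        moreover have "b + (- ?c) *s v \<in> B"
          using b vB B_sub vec.subspace_add vec.subspace_scale by blast
        ultimately have "(b + (- ?c) *s v) $ j = 0" using nj by (auto simp: supp_def K_def)
        then show ?thesis by simp
      qed
      obtain b where "b \<in> B" "b $ j \<noteq> 0" using j by (auto simp: supp_def)
      then have nz: "v $ j \<noteq> 0" using ratio[of b] by auto
      have "y = (\<lambda>u\<in>S. y v / v $ j * u $ j)"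
      proof
        fix u
        show "y u = (\<lambda>u\<in>S. y v / v $ j * u $ j) u"
        proof (cases "u \<in> S")
          case True
          then have "u $ j = y u / y v * v $ j" using ratio[of u] S(1) f_basis by auto
          then show ?thesis using True nz v by (simp add: field_simps)
        next
          case False
          then show ?thesis using y by (auto simp: Y_def PiE_def extensional_def)
        qed
      qed
      moreover have "y v / v $ j \<in> UNIV - {0}" using v nz by simp
      ultimately show "y \<in> (\<lambda>\<mu>. \<lambda>v\<in>S. \<mu> * v $ j) ` (UNIV - {0})" by blast
    qed
    then have "card {y \<in> Y. j \<notin> supp (K y)} \<le> card (UNIV - {0 :: 'a})"
      by (intro surj_card_le) auto
    then show ?thesis by simp
  qed
  have hit: "(?q - 1) * (?q * q_bracket ?q s) \<le> card {y \<in> Y. j \<in> supp (K y)}"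
    if j: "j \<in> supp B" for j
  proof -
    have "Y = {y \<in> Y. j \<in> supp (K y)} \<union> {y \<in> Y. j \<notin> supp (K y)}" by auto
    then have "card Y = card {y \<in> Y. j \<in> supp (K y)} + card {y \<in> Y. j \<notin> supp (K y)}"
      using fY by (subst card_Un_disjoint[symmetric]) auto
    \<comment> \<open>In this form the q - 1 functionals that may miss \<open>j\<close> are exactly
      the summand 1.\<close>
    moreover have "card Y = (?q - 1) * (1 + ?q * q_bracket ?q s)"
      using cY q_bracket_exact[OF q, of "Suc s"] q_bracket_Suc[OF q] by simp
    ultimately show ?thesis using missed[OF j] by simp
  qed
  have "(?q - 1) * (?q * q_bracket ?q s) * support_weight B
      = (\<Sum>j\<in>supp B. (?q - 1) * (?q * q_bracket ?q s))"
    by (simp add: support_weight_def)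
  also have "\<dots> \<le> (\<Sum>j\<in>supp B. card {y \<in> Y. j \<in> supp (K y)})"
    using hit by (intro sum_mono)
  also have "\<dots> = (\<Sum>y\<in>Y. card {j \<in> supp B. j \<in> supp (K y)})"
    using fY by (intro sum_multicount_gen) auto
  also have "\<dots> \<le> (\<Sum>y\<in>Y. max_weight s C)"
  proof (rule sum_mono)
    fix y assume y: "y \<in> Y"
    have "card {j \<in> supp B. j \<in> supp (K y)} \<le> support_weight (K y)"
      unfolding support_weight_def by (intro card_mono) auto
    also have "\<dots> \<le> max_weight s C" using support_weight_le_max_weight[OF K_sub[OF y]] .
    finally show "card {j \<in> supp B. j \<in> supp (K y)} \<le> max_weight s C" .
  qed
  also have "\<dots> = (?q - 1) * (q_bracket ?q (Suc s) * max_weight s C)"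
    using cY q_bracket_exact[OF q, of "Suc s"] by (simp add: mult.assoc[symmetric])
  finally have "(?q - 1) * (?q * q_bracket ?q s * support_weight B)
      \<le> (?q - 1) * (q_bracket ?q (Suc s) * max_weight s C)" by (simp only: mult.assoc)
  then show ?thesis using q by simp
qed

lemma max_weight_Suc:
  fixes C :: "('a::{field,finite} ^ 'n::finite) set"
  assumes "vec.subspace C" "Suc s \<le> vec.dim C"
  shows "CARD('a) * q_bracket CARD('a) s * max_weight (Suc s) C
       \<le> q_bracket CARD('a) (Suc s) * max_weight s C"
  using max_weight_attained[OF assms] support_weight_averaging by metis

text \<open>By \<open>q_bracket_Suc\<close>, averaging bounds the increment times
  \<open>q * q_bracket q s\<close> by \<open>max_weight s C\<close>. The increment is an integer,
  which allows the floor.\<close>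

lemma max_weight_Suc_le:
  fixes C :: "('a::{field,finite} ^ 'n::finite) set"
  assumes "vec.subspace C" "Suc s \<le> vec.dim C" "1 \<le> s"
  shows "max_weight (Suc s) C - max_weight s C \<le> max_weight s C div (CARD('a) * q_bracket CARD('a) s)"
proof -
  let ?b = "CARD('a) * q_bracket CARD('a) s"
  have q: "2 \<le> CARD('a)" by (rule two_le_card_field)
  have "?b * max_weight (Suc s) C \<le> ?b * max_weight s C + max_weight s C"
    using max_weight_Suc[OF assms(1,2)] q_bracket_Suc[OF q, of s] by (simp add: algebra_simps)
  then have "(max_weight (Suc s) C - max_weight s C) * ?b \<le> max_weight s C"
    by (simp add: diff_mult_distrib algebra_simps)
  moreover have "0 < ?b" using q_bracket_pos[OF q assms(3)] q by simp
  ultimately show ?thesis by (simp add: less_eq_div_iff_mult_less_eq)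
qed

text \<open>Chains \<open>max_weight_Suc\<close> d times; the intermediate brackets cancel.\<close>

lemma max_weight_add:
  fixes C :: "('a::{field,finite} ^ 'n::finite) set"
  assumes C: "vec.subspace C" and h: "1 \<le> h" and d: "d + h \<le> vec.dim C"
  shows "CARD('a) ^ d * q_bracket CARD('a) h * max_weight (d + h) C
       \<le> q_bracket CARD('a) (d + h) * max_weight h C"
  using d
proof (induction d)
  case (Suc d)
  let ?q = "CARD('a)" and ?b = "q_bracket CARD('a)" and ?w = "\<lambda>i. max_weight i C"
  \<comment> \<open>The extra factor \<open>?b (d + h)\<close> clears the denominator between the
    two inequalities. It is positive because of \<open>h\<close>, and is cancelled at the
    end.\<close>
  have "?b (d + h) * (?q ^ Suc d * ?b h * ?w (Suc d + h))
      = ?q ^ d * ?b h * (?q * ?b (d + h) * ?w (Suc (d + h)))" by simp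
  also have "\<dots> \<le> ?q ^ d * ?b h * (?b (Suc (d + h)) * ?w (d + h))"
    using Suc.prems C by (intro mult_left_mono max_weight_Suc) auto
  also have "\<dots> = ?b (Suc (d + h)) * (?q ^ d * ?b h * ?w (d + h))" by simp
  also have "\<dots> \<le> ?b (Suc (d + h)) * (?b (d + h) * ?w h)"
    using Suc by (intro mult_left_mono) auto
  also have "\<dots> = ?b (d + h) * (?b (Suc d + h) * ?w h)" by simp
  finally show ?case
    using q_bracket_pos[OF two_le_card_field[where 'a = 'a], of "d + h"] h by simp
qed simp

section \<open>Residual codes\<close>

lemma linear_puncture:
  "Vector_Spaces.linear (*s) (*s) (\<lambda>c :: 'a::field ^ 'n::finite. \<chi> j. if j \<in> J then 0 else c $ j)"
  by unfold_locales (auto simp: vec_eq_iff algebra_simps)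

lemma subspace_Res:
  "vec.subspace C \<Longrightarrow> vec.subspace (Res C A :: ('a::field ^ 'n::finite) set)"
  unfolding Res_def
  by (rule module_hom.subspace_image[OF Vector_Spaces.linear.axioms(3)[OF linear_puncture]])

lemma supp_Res: "supp (Res C A) = supp C - supp A"
  unfolding Res_def by (subst supp_def) (auto simp: supp_def[of C])

lemma support_weight_Res:
  assumes "A \<subseteq> C"
  shows "support_weight A + support_weight (Res C A) = support_weight C"
  using supp_mono[OF assms]
  by (simp add: support_weight_def supp_Res card_Diff_subset card_mono)

text \<open>Preimages in \<open>C\<close> of a basis of \<open>D\<close> are adjoined to
  \<open>A\<close>. Puncturing kills \<open>A\<close> and keeps these preimages independent modulo
  \<open>A\<close>. The support outside \<open>supp A\<close> is that of \<open>D\<close>.\<close>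

lemma Res_lift:
  fixes C :: "('a::field ^ 'n::finite) set"
  assumes C: "vec.subspace C" and A: "subcode h A C" and D: "subcode m D (Res C A)"
  obtains B where "subcode (h + m) B C" "support_weight B = support_weight A + support_weight D"
proof -
  define p where "p = (\<lambda>c :: 'a ^ 'n. \<chi> j. if j \<in> supp A then 0 else c $ j)"
  interpret p: Vector_Spaces.linear "(*s)" "(*s)" p unfolding p_def by (rule linear_puncture)
  obtain T where T: "T \<subseteq> D" "vec.independent T" "D \<subseteq> vec.span T" "card T = m"
    using vec.basis_exists[of D] D by (metis subcode_def)
  have "\<exists>g. \<forall>t\<in>D. g t \<in> C \<and> p (g t) = t"
    using D by (intro bchoice) (auto simp: subcode_def Res_def p_def)
  then obtain g where g: "\<And>t. t \<in> D \<Longrightarrow> g t \<in> C" "\<And>t. t \<in> D \<Longrightarrow> p (g t) = t" by blast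
  have pA: "p a = 0" if "a \<in> A" for a using that by (auto simp: p_def vec_eq_iff supp_def)
  have dim: "vec.dim (A \<union> g ` U) = h + card U" if "U \<subseteq> T" "finite U" for U
    using that(2,1)
  proof (induction U)
    case empty
    then show ?case using A by (simp add: subcode_def)
  next
    case (insert t U)
    \<comment> \<open>Under \<open>p\<close>, a dependence of \<open>g t\<close> on \<open>A\<close>
      and the earlier preimages would become a dependence of \<open>t\<close> on \<open>U\<close>,
      inside the independent set \<open>T\<close>.\<close>
    have "g t \<notin> vec.span (A \<union> g ` U)"
    proof
      assume "g t \<in> vec.span (A \<union> g ` U)"
      then have "p (g t) \<in> vec.span (p ` (A \<union> g ` U))" by (auto simp: p.span_image)
      moreover have "p ` (A \<union> g ` U) \<subseteq> vec.span U"
      proof safe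
        fix x assume "x \<in> A"
        then show "p x \<in> vec.span U" using pA vec.span_zero by simp
      next
        fix u assume "u \<in> U"
        moreover from this have "u \<in> D" using insert.prems T(1) by auto
        ultimately show "p (g u) \<in> vec.span U" using g(2) vec.span_base by simp
      qed
      then have "vec.span (p ` (A \<union> g ` U)) \<subseteq> vec.span U"
        by (rule vec.span_minimal[OF _ vec.subspace_span])
      moreover have "p (g t) = t" using g(2) insert.prems T(1) by auto
      ultimately have "t \<in> vec.span U" by auto
      moreover have "U \<subseteq> T - {t}" using insert by auto
      ultimately have "t \<in> vec.span (T - {t})" using vec.span_mono by blast
      then show False using T(2) insert.prems by (auto simp: vec.dependent_def)
    qed
    then show ?case using insert by (simp add: vec.dim_insert)
  qed
  have fT: "finite T" using T(2) vec.finiteI_independent by blast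
  define B where "B = vec.span (A \<union> g ` T)"
  have "A \<union> g ` T \<subseteq> C" using A g T(1) by (auto simp: subcode_def)
  then have "B \<subseteq> C" unfolding B_def using C by (rule vec.span_minimal)
  then have "subcode (h + m) B C"
    using dim[OF subset_refl fT] T(4) by (simp add: subcode_def B_def vec.subspace_span)
  moreover have "support_weight B = support_weight A + support_weight D"
  proof -
    have "D = vec.span T" using T D vec.span_minimal[of T D] by (auto simp: subcode_def)
    moreover have "T = p ` g ` T" using g(2) T(1) by (force simp: image_iff)
    ultimately have "supp D = supp (p ` g ` T)" by (simp add: supp_span)
    also have "\<dots> = supp (g ` T) - supp A"
      using supp_Res[of "g ` T" A] by (simp add: Res_def p_def)
    finally have "supp B = supp A \<union> supp D" "supp A \<inter> supp D = {}"
      by (auto simp: B_def supp_span supp_Un)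
    then show ?thesis by (simp add: support_weight_def card_Un_disjoint)
  qed
  ultimately show ?thesis by (rule that)
qed

text \<open>The whole residual code is lifted. Equality can fail, since puncturing also kills words
  outside \<open>A\<close> whose support lies in \<open>supp A\<close>.\<close>

lemma dim_Res:
  fixes C :: "('a::field ^ 'n::finite) set"
  assumes C: "vec.subspace C" and A: "subcode h A C"
  shows "h + vec.dim (Res C A) \<le> vec.dim C"
proof -
  have "subcode (vec.dim (Res C A)) (Res C A) (Res C A)"
    using subspace_Res[OF C] by (simp add: subcode_def)
  then obtain B where "subcode (h + vec.dim (Res C A)) B C" using Res_lift[OF C A] by blast
  then show ?thesis using vec.dim_subset by (metis subcode_def)
qed

text \<open>A heaviest subcode of the residual code lifts to dimension \<open>h + m\<close>, and
  monotonicity bridges the gap to \<open>r\<close>. That gap occurs when the residual code has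
  dimension below \<open>r - h\<close>.\<close>

lemma max_weight_Res:
  fixes C :: "('a::{field,finite} ^ 'n::finite) set"
  assumes C: "vec.subspace C" and A: "subcode h A C" and m: "m \<le> vec.dim (Res C A)"
    and r: "h + m \<le> r" "r \<le> vec.dim C"
  shows "support_weight A + max_weight m (Res C A) \<le> max_weight r C"
proof -
  obtain D where D: "subcode m D (Res C A)" "support_weight D = max_weight m (Res C A)"
    using max_weight_attained[OF subspace_Res[OF C] m] .
  obtain B where "subcode (h + m) B C" "support_weight B = support_weight A + support_weight D"
    using Res_lift[OF C A D(1)] .
  then have "support_weight A + max_weight m (Res C A) \<le> max_weight (h + m) C"
    using support_weight_le_max_weight D(2) by metis
  also have "\<dots> \<le> max_weight r C" using max_weight_mono[OF C r] .
  finally show ?thesis .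
qed

section \<open>The bound and its case of equality\<close>

text \<open>The induction generalizes \<open>r\<close> because the residual code is always compared
  with the bound for r = 1. Its maximum weight is at most the increment from
  \<open>max_weight r C\<close> to \<open>max_weight (Suc r) C\<close>, hence at most the first
  floor.\<close>

theorem support_weight_le_antiGriesmer_bound:
  fixes C :: "('a::{field,finite} ^ 'n::finite) set"
  assumes "vec.subspace C" "1 \<le> r" "r \<le> vec.dim C"
  shows "support_weight C \<le> antiGriesmer_bound CARD('a) r (vec.dim C) (max_weight r C)"
  using assms
proof (induction "vec.dim C" arbitrary: C r rule: less_induct)
  case less
  let ?q = "CARD('a)"
  have q: "2 \<le> ?q" by (rule two_le_card_field)
  obtain A where A: "subcode r A C" "support_weight A = max_weight r C"
    using max_weight_attained less.prems by blast
  define R where "R = Res C A"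
  have R: "vec.subspace R" unfolding R_def using subspace_Res less.prems by blast
  have dR: "r + vec.dim R \<le> vec.dim C" unfolding R_def using dim_Res less.prems A by blast
  have len: "support_weight C = max_weight r C + support_weight R"
    using support_weight_Res[of A C] A by (simp add: R_def subcode_def)
  show ?case
  proof (cases "vec.dim R = 0")
    case True
    then have "support_weight R = 0" by (simp add: support_weight_eq_0 vec.dim_eq_0)
    then show ?thesis using len by (simp add: antiGriesmer_bound_def)
  next
    case False
    then have pos: "1 \<le> vec.dim R" by linarith
    then have "max_weight r C + max_weight 1 R \<le> max_weight (Suc r) C"
      using max_weight_Res[OF less.prems(1) A(1), of 1 "Suc r"] dR A(2)
      by (simp add: R_def)
    then have "max_weight 1 R \<le> max_weight r C div (?q * q_bracket ?q r)"
      using max_weight_Suc_le[OF less.prems(1) _ less.prems(2)] False dR by simp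
    moreover have "support_weight R \<le> antiGriesmer_bound ?q 1 (vec.dim R) (max_weight 1 R)"
      using pos dR less.prems R by (intro less.hyps) linarith+
    ultimately have "support_weight R
        \<le> antiGriesmer_bound ?q 1 (vec.dim C - r) (max_weight r C div (?q * q_bracket ?q r))"
      using dR by (elim order_trans) (auto intro!: antiGriesmer_bound_mono)
    then show ?thesis
      using len antiGriesmer_bound_unfold[OF q, of r "vec.dim C"] False dR by simp
  qed
qed

text \<open>The length is at most the bound at the true maximum weight, which is at most the bound
  at \<open>X\<close>, which by \<open>len\<close> is at most the length. Strict monotonicity then
  identifies the two arguments.\<close>

lemma gen_antiGriesmer_squeeze:
  fixes R :: "('a::{field,finite} ^ 'n::finite) set"
  assumes R: "vec.subspace R" and m: "1 \<le> m" "m \<le> vec.dim R"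
    and X: "max_weight m R \<le> X"
    and len: "antiGriesmer_bound CARD('a) m (vec.dim R) X \<le> support_weight R"
  shows "support_weight R = antiGriesmer_bound CARD('a) m (vec.dim R) X"
    and "max_weight m R = X"
    and "gen_antiGriesmer m (supp R) (support_weight R) (vec.dim R) R"
proof -
  have bound: "support_weight R \<le> antiGriesmer_bound CARD('a) m (vec.dim R) (max_weight m R)"
    using support_weight_le_antiGriesmer_bound[OF R m] .
  show max: "max_weight m R = X"
  proof (rule ccontr)
    assume "max_weight m R \<noteq> X"
    then have "antiGriesmer_bound CARD('a) m (vec.dim R) (max_weight m R)
        < antiGriesmer_bound CARD('a) m (vec.dim R) X"
      using X by (intro antiGriesmer_bound_strict_mono) auto
    then show False using bound len by simp
  qed
  show eq: "support_weight R = antiGriesmer_bound CARD('a) m (vec.dim R) X"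
    using bound len max by simp
  show "gen_antiGriesmer m (supp R) (support_weight R) (vec.dim R) R"
    using linear_code_supp[OF R] m eq max by (simp add: gen_antiGriesmer_def)
qed

text \<open>When \<open>C\<close> meets its bound, the right-hand side is its length, so this
  supplies the lower bound on the residual length for \<open>gen_antiGriesmer_squeeze\<close>. The
  floors are compared one by one.\<close>

lemma antiGriesmer_bound_Res_le:
  fixes C :: "('a::{field,finite} ^ 'n::finite) set"
  assumes C: "vec.subspace C" and h: "1 \<le> h" "h < r" and r: "r \<le> vec.dim C"
    and k': "h + k' \<le> vec.dim C"
  shows "max_weight h C
      + antiGriesmer_bound CARD('a) (min k' (r - h)) k' (max_weight r C - max_weight h C)
      \<le> antiGriesmer_bound CARD('a) r (vec.dim C) (max_weight r C)"
proof -
  let ?q = "CARD('a)" and ?b = "q_bracket CARD('a)"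
  let ?x = "max_weight r C - max_weight h C"
  have q: "2 \<le> ?q" by (rule two_le_card_field)
  have mono: "max_weight h C \<le> max_weight r C" using max_weight_mono[OF C] h r by simp
  show ?thesis
  proof (cases "k' \<le> r - h")
    \<comment> \<open>Here the minimum is \<open>k'\<close>, so the residual bound has no floors and
      the left-hand side is just \<open>max_weight r C\<close>.\<close>
    case True
    then show ?thesis using mono by (simp add: antiGriesmer_bound_def)
  next
    case False
    \<comment> \<open>Splitting \<open>?b r\<close> this way turns \<open>max_weight_add\<close>
      into a comparison of ratios: \<open>?x\<close> over \<open>?b (r - h)\<close> is at most
      \<open>max_weight r C\<close> over \<open>?b r\<close>.\<close>
    have split: "?b r = ?b (r - h) + ?q ^ (r - h) * ?b h"
      using q_bracket_add[OF q, of "r - h" h] h by simp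
    have "?q ^ (r - h) * ?b h * max_weight r C \<le> ?b r * max_weight h C"
      using max_weight_add[OF C h(1), of "r - h"] h r by simp
    moreover have "max_weight r C * ?b r
        = max_weight r C * ?b (r - h) + ?q ^ (r - h) * ?b h * max_weight r C"
      by (simp add: split algebra_simps)
    ultimately have "?x * ?b r \<le> max_weight r C * ?b (r - h)"
      by (simp add: diff_mult_distrib mult.commute[of "max_weight h C"])
    have le: "?x div (?q ^ i * ?b (r - h)) \<le> max_weight r C div (?q ^ i * ?b r)" for i
    proof -
      let ?y = "?x div (?q ^ i * ?b (r - h))"
      have pos: "0 < ?b (r - h)" "0 < ?b r" using q_bracket_pos[OF q] h by auto
      have "?y * (?q ^ i * ?b (r - h)) \<le> ?x" by simp
      then have "?y * (?q ^ i * ?b (r - h)) * ?b r \<le> ?x * ?b r" by (rule mult_right_mono) simp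
      also have "\<dots> \<le> max_weight r C * ?b (r - h)" by fact
      finally have "?b (r - h) * (?y * (?q ^ i * ?b r)) \<le> ?b (r - h) * max_weight r C"
        by (simp only: ac_simps)
      then have "?y * (?q ^ i * ?b r) \<le> max_weight r C" using pos by simp
      then show ?thesis using pos q by (simp add: less_eq_div_iff_mult_less_eq)
    qed
    have "(\<Sum>i=1..k' - (r - h). ?x div (?q ^ i * ?b (r - h)))
        \<le> (\<Sum>i=1..k' - (r - h). max_weight r C div (?q ^ i * ?b r))"
      by (intro sum_mono le)
    \<comment> \<open>The residual sum is no longer than the original one, by \<open>k'\<close> and
      \<open>h < r\<close>.\<close>
    also have "\<dots> \<le> (\<Sum>i=1..vec.dim C - r. max_weight r C div (?q ^ i * ?b r))"
      using k' h by (intro sum_mono2) auto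
    finally show ?thesis using False mono by (simp add: antiGriesmer_bound_def min_def)
  qed
qed

theorem theorem5p7:
  fixes C :: "('a::{field,finite} ^ 'n::finite) set" and q n k r :: nat and \<delta> :: "nat \<Rightarrow> nat"
  assumes q: "q = CARD('a)"
    and n: "n = CARD('n)"
    and r: "1 \<le> r" "r \<le> k"
    and code: "linear_code (UNIV :: 'n set) n k C"
    and aG: "gen_antiGriesmer r (UNIV :: 'n set) n k C"
    and \<delta>: "\<And>i. \<delta> i = max_weight i C"
  shows
    "(\<forall>h A R k' m.
        1 \<le> h \<longrightarrow> h < r \<longrightarrow> subcode h A C \<longrightarrow> support_weight A = \<delta> h \<longrightarrow>
        R = Res C A \<longrightarrow> k' = vec.dim R \<longrightarrow> m = min k' (r - h) \<longrightarrow>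
          (R = {0} \<longrightarrow> n = \<delta> h \<and> \<delta> h = \<delta> r) \<and>
          (R \<noteq> {0} \<longrightarrow>
             effective_length R = antiGriesmer_bound q m k' (\<delta> r - \<delta> h) \<and>
             max_weight m R = \<delta> r - \<delta> h \<and>
             gen_antiGriesmer m (supp R) (effective_length R) k' R)) \<and>
     (\<forall>A R k'.
        r < k \<longrightarrow> subcode r A C \<longrightarrow> support_weight A = \<delta> r \<longrightarrow>
        R = Res C A \<longrightarrow> R \<noteq> {0} \<longrightarrow> k' = vec.dim R \<longrightarrow>
          linear_code (supp R) (antiGriesmer_bound q 1 k' (\<delta> (r + 1) - \<delta> r)) k' R \<and>
          max_hamming_weight R = \<delta> (r + 1) - \<delta> r \<and>
          antiGriesmer (supp R) (effective_length R) k' R)"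
proof -
  have C: "vec.subspace C" and k: "k = vec.dim C" using code by (auto simp: linear_code_def)
  have len: "support_weight C = n" "n = antiGriesmer_bound q r k (\<delta> r)"
    using aG q \<delta> by (auto simp: gen_antiGriesmer_def)
  have dim_pos: "1 \<le> vec.dim R" if "vec.subspace R" "R \<noteq> {0}" for R :: "('a ^ 'n) set"
    using that vec.dim_eq_0[of R] vec.subspace_0[of R] by fastforce
  have part1: "(R = {0} \<longrightarrow> n = \<delta> h \<and> \<delta> h = \<delta> r) \<and>
      (R \<noteq> {0} \<longrightarrow>
         effective_length R = antiGriesmer_bound q m k' (\<delta> r - \<delta> h) \<and>
         max_weight m R = \<delta> r - \<delta> h \<and>
         gen_antiGriesmer m (supp R) (effective_length R) k' R)"
    if h: "1 \<le> h" "h < r" and A: "subcode h A C" "support_weight A = \<delta> h"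
      and R: "R = Res C A" "k' = vec.dim R" "m = min k' (r - h)" for h A R k' m
  proof (intro conjI impI)
    have nR: "\<delta> h + support_weight R = n"
      using support_weight_Res[of A C] A R len by (simp add: subcode_def)
    {
      assume "R = {0}"
      then have "support_weight R = 0" by (simp add: support_weight_eq_0)
      then show "n = \<delta> h" using nR by simp
      \<comment> \<open>The chain \<delta> h \<le> \<delta> r \<le> n closes up, since n = \<delta>
        h.\<close>
      then show "\<delta> h = \<delta> r"
        using max_weight_mono[OF C, of h r] max_weight_le_support_weight[OF C, of r] h r k len \<delta>
        by simp
    }
    assume "R \<noteq> {0}"
    have sR: "vec.subspace R" using subspace_Res[OF C] R by simp
    have k'_pos: "1 \<le> k'" using dim_pos[OF sR \<open>R \<noteq> {0}\<close>] R by simp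
    have dR: "h + k' \<le> vec.dim C" using dim_Res[OF C A(1)] R by simp
    have "m \<le> vec.dim R" "h + m \<le> r" using R h by auto
    then have "max_weight m R \<le> \<delta> r - \<delta> h"
      using max_weight_Res[OF C A(1), of m r] R(1) r k A(2) \<delta> by simp
    \<comment> \<open>Both sides are shifted by \<delta> h: the right one becomes n, which is the
      bound for \<open>C\<close> by hypothesis.\<close>
    moreover have "antiGriesmer_bound CARD('a) m (vec.dim R) (\<delta> r - \<delta> h) \<le> support_weight R"
      using antiGriesmer_bound_Res_le[OF C h _ dR] nR len q k r R \<delta> by simp
    ultimately show "effective_length R = antiGriesmer_bound q m k' (\<delta> r - \<delta> h)"
      "max_weight m R = \<delta> r - \<delta> h"
      "gen_antiGriesmer m (supp R) (effective_length R) k' R"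
      using gen_antiGriesmer_squeeze[OF sR, of m "\<delta> r - \<delta> h"] R h k'_pos q by auto
  qed
  have part2: "linear_code (supp R) (antiGriesmer_bound q 1 k' (\<delta> (r + 1) - \<delta> r)) k' R \<and>
      max_hamming_weight R = \<delta> (r + 1) - \<delta> r \<and>
      antiGriesmer (supp R) (effective_length R) k' R"
    if "r < k" and A: "subcode r A C" "support_weight A = \<delta> r"
      and R: "R = Res C A" "R \<noteq> {0}" "k' = vec.dim R" for A R k'
  proof -
    have sR: "vec.subspace R" using subspace_Res[OF C] R by simp
    have k'_pos: "1 \<le> vec.dim R" using dim_pos[OF sR R(2)] .
    have dR: "r + vec.dim R \<le> vec.dim C" using dim_Res[OF C A(1)] R by simp
    have nR: "\<delta> r + support_weight R = n"
      using support_weight_Res[of A C] A R len by (simp add: subcode_def)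
    have max: "max_weight 1 R \<le> \<delta> (r + 1) - \<delta> r"
      using max_weight_Res[OF C A(1), of 1 "r + 1"] R k'_pos dR A(2) \<delta> by simp
    have "\<delta> (r + 1) - \<delta> r \<le> \<delta> r div (q * q_bracket q r)"
      using max_weight_Suc_le[OF C _ r(1)] \<open>r < k\<close> k \<delta> q by simp
    \<comment> \<open>Monotonicity is needed in both arguments, as \<open>vec.dim R\<close> may be
      smaller than \<open>k - r\<close>.\<close>
    then have "antiGriesmer_bound q 1 (vec.dim R) (\<delta> (r + 1) - \<delta> r)
        \<le> antiGriesmer_bound q 1 (k - r) (\<delta> r div (q * q_bracket q r))"
      using dR k by (intro antiGriesmer_bound_mono) auto
    \<comment> \<open>Removing \<delta> r from the unfolded equality for n leaves the residual
      length.\<close>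
    also have "\<dots> = support_weight R"
      using antiGriesmer_bound_unfold[of q r k "\<delta> r"] two_le_card_field[where 'a = 'a]
        \<open>r < k\<close> len nR q by simp
    finally have "antiGriesmer_bound q 1 (vec.dim R) (\<delta> (r + 1) - \<delta> r) \<le> support_weight R" .
    then show ?thesis
      using gen_antiGriesmer_squeeze[OF sR le_refl k'_pos max] linear_code_supp[OF sR]
        max_hamming_weight_eq[OF sR k'_pos] R q by simp
  qed
  show ?thesis using part1 part2 by blast
qed

end
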